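(* Regular spaces with a uniform base at non-isolated points do not satisfy the decomposition theorem. That is, there exist a regular Hausdorff space $X$ with a uniform base at non-isolated points, a Hausdorff space $Y$, and a continuous closed surjection $f:X\rightarrow Y$ such that there is no subset $Z\subset Y$ which is a countable union of closed discrete subsets of $Y$ and for which $f^{-1}(y)$ is compact for every $y\in Y-Z$.
   Context: A base $\mathcal{P}$ of a topological space $X$ is called a uniform base at non-isolated points for $X$ if for each non-isolated point $x\in X$ and each countably infinite subset $\mathcal{P}'$ of $\{P\in\mathcal{P}:x\in P\}$, the family $\mathcal{P}'$ is a neighborhood base at $x$ in $X$. A topological property $\Xi$ is said to satisfy the decomposition theorem if, for any space $X$ with the property $\Xi$ and any closed map $f:X\rightarrow Y$, there exists a $\sigma$-closed discrete subset $Z\subset Y$ (a countable union of closed discrete subsets of $Y$) such that $f^{-1}(y)$ is compact in $X$ for any $y\in Y-Z$. All spaces are assumed to be Hausdorff and all maps are continuous and onto. *)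

theory Defs
  imports "HOL-Analysis.Analysis"
begin

definition is_base :: "'a topology \<Rightarrow> 'a set set \<Rightarrow> bool" where
  "is_base X \<B> \<longleftrightarrow> openin X = arbitrary union_of (\<lambda>B. B \<in> \<B>)"

definition isolated_point :: "'a topology \<Rightarrow> 'a \<Rightarrow> bool" where
  "isolated_point X x \<longleftrightarrow> openin X {x}"

(* neighbourhood_base_at only asks that every open set around x contain a member of the
   family that is a neighbourhood of x.  Here all members of \<Q> are open and contain x,
   so this is the usual notion of a neighbourhood base at x. *)
definition uniform_base_at_nonisolated :: "'a topology \<Rightarrow> 'a set set \<Rightarrow> bool" where
  "uniform_base_at_nonisolated X \<B> \<longleftrightarrow>
     is_base X \<B> \<and>
     (\<forall>x \<in> topspace X. \<not> isolated_point X x \<longrightarrow>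
        (\<forall>\<Q>. \<Q> \<subseteq> {B \<in> \<B>. x \<in> B} \<and> countable \<Q> \<and> infinite \<Q> \<longrightarrow>
           neighbourhood_base_at x (\<lambda>B. B \<in> \<Q>) X))"

definition closed_discrete_in :: "'a topology \<Rightarrow> 'a set \<Rightarrow> bool" where
  "closed_discrete_in X S \<longleftrightarrow> closedin X S \<and> subtopology X S = discrete_topology S"

definition sigma_closed_discrete_in :: "'a topology \<Rightarrow> 'a set \<Rightarrow> bool" where
  "sigma_closed_discrete_in X = countable union_of closed_discrete_in X"

end

theory Submission
  imports Defs
begin

text \<open>
  Let \<open>D\<close> be an uncountable set and let \<open>L\<close> index a maximal almost disjoint family of sequences in
  \<open>D\<close>; let \<open>Y\<close> be the corresponding Isbell--Mrowka space on \<open>D \<union> L\<close>. If \<open>Z \<supseteq> D\<close> were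
  \<open>\<sigma>\<close>-closed discrete, one of the closed discrete pieces would contain infinitely many points of
  \<open>D\<close>, and by maximality these would accumulate at a point of \<open>L\<close>.
  Now split every point of \<open>D\<close> into infinitely many isolated points, letting a neighbourhood of a
  point of \<open>L\<close> contain almost all of the split points of its sequence entirely. The projection back
  to \<open>Y\<close> is closed because neighbourhoods of points of \<open>L\<close> can be taken saturated, while the fibres
  over \<open>D\<close> are infinite and discrete, so that \<open>Z\<close> has to contain \<open>D\<close>.
\<close>

section \<open>Isolated points \<open>I\<close> and limit points \<open>L\<close> approached by
  sequences of blocks\<close>

locale fan_space =
  fixes I L :: "'a set" and A :: "'a \<Rightarrow> nat \<Rightarrow> 'a set"
  assumes disjoint: "I \<inter> L = {}"
    and fan_subset: "y \<in> L \<Longrightarrow> A y n \<subseteq> I"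
    and fan_leaves_point: "y \<in> L \<Longrightarrow> p \<in> I \<Longrightarrow> \<forall>\<^sub>F n in sequentially. p \<notin> A y n"
    and fans_almost_disjoint: "y \<in> L \<Longrightarrow> z \<in> L \<Longrightarrow> y \<noteq> z \<Longrightarrow>
      \<forall>\<^sub>F n in sequentially. A z n \<inter> (\<Union>m. A y m) = {}"
begin

text \<open>Points of \<open>I\<close> carry no condition and are isolated; a neighbourhood of
  \<open>y\<close> in \<open>L\<close> must swallow almost all blocks \<open>A y n\<close> whole.
  Singleton blocks give the Isbell-Mrowka space, larger blocks the space in which points are split,
  so one locale serves both.\<close>

definition fan_open :: "'a set \<Rightarrow> bool" where
  "fan_open U \<longleftrightarrow> U \<subseteq> I \<union> L \<and> (\<forall>y\<in>L \<inter> U. \<forall>\<^sub>F n in sequentially. A y n \<subseteq> U)"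

definition fan_topology :: "'a topology" where
  "fan_topology = topology fan_open"

definition tail_nhd :: "'a \<Rightarrow> nat \<Rightarrow> 'a set" where
  "tail_nhd y N = insert y (\<Union>n\<in>{N..}. A y n)"

definition fan_base :: "'a set set" where
  "fan_base = (\<lambda>p. {p}) ` I \<union> (\<Union>y\<in>L. range (tail_nhd y))"

lemma openin_fan_topology: "openin fan_topology U \<longleftrightarrow> fan_open U"
proof -
  have "istopology fan_open"
    unfolding istopology_def
  proof (intro conjI allI impI)
    fix S T assume "fan_open S" "fan_open T"
    then show "fan_open (S \<inter> T)"
      unfolding fan_open_def by (auto intro: eventually_conj)
  next
    fix \<K> assume "\<forall>K\<in>\<K>. fan_open K"
    then have sub: "\<Union>\<K> \<subseteq> I \<union> L"
      and ev: "\<And>K y. K \<in> \<K> \<Longrightarrow> y \<in> L \<inter> K \<Longrightarrow> \<forall>\<^sub>F n in sequentially. A y n \<subseteq> K"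
      unfolding fan_open_def by auto
    show "fan_open (\<Union>\<K>)"
      unfolding fan_open_def
    proof (intro conjI sub ballI)
      fix y assume "y \<in> L \<inter> \<Union>\<K>"
      then obtain K where K: "K \<in> \<K>" "y \<in> L \<inter> K" by auto
      show "\<forall>\<^sub>F n in sequentially. A y n \<subseteq> \<Union>\<K>"
        using ev[OF K] by (rule eventually_mono) (use K in auto)
    qed
  qed
  then show ?thesis
    by (simp add: fan_topology_def topology_inverse')
qed

lemma openin_fan_eventually:
  "openin fan_topology U \<Longrightarrow> y \<in> L \<Longrightarrow> y \<in> U \<Longrightarrow> \<forall>\<^sub>F n in sequentially. A y n \<subseteq> U"
  by (auto simp: openin_fan_topology fan_open_def)

lemma topspace_fan_topology [simp]: "topspace fan_topology = I \<union> L"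
proof -
  have "openin fan_topology (I \<union> L)"
    using fan_subset by (auto simp: openin_fan_topology fan_open_def le_supI1)
  then show ?thesis
    by (meson fan_open_def openin_fan_topology openin_subset openin_topspace subset_antisym)
qed

lemma openin_fan_subset_isolated: "U \<subseteq> I \<Longrightarrow> openin fan_topology U"
  using disjoint by (auto simp: openin_fan_topology fan_open_def)

section \<open>Clopen neighbourhoods and separation\<close>

lemma closedin_fan_singleton:
  assumes "p \<in> I \<union> L" shows "closedin fan_topology {p}"
proof -
  have "\<forall>\<^sub>F n in sequentially. A y n \<subseteq> I \<union> L - {p}" if "y \<in> L" "y \<noteq> p" for y
  proof (cases "p \<in> I")
    case True
    show ?thesis
      using fan_leaves_point[OF \<open>y \<in> L\<close> True] by (rule eventually_mono) (use fan_subset that in blast)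
  next
    case False
    then show ?thesis
      using fan_subset[OF \<open>y \<in> L\<close>] by (auto intro!: always_eventually)
  qed
  then show ?thesis
    using assms by (auto simp: closedin_def openin_fan_topology fan_open_def)
qed

lemma openin_tail_nhd:
  assumes "y \<in> L" shows "openin fan_topology (tail_nhd y N)"
proof -
  have "\<forall>\<^sub>F n in sequentially. A y n \<subseteq> tail_nhd y N"
    using eventually_ge_at_top[of N] by (rule eventually_mono) (auto simp: tail_nhd_def)
  then show ?thesis
    using assms fan_subset[OF assms] disjoint
    by (auto simp: openin_fan_topology fan_open_def tail_nhd_def)
qed

text \<open>Almost disjointness is what makes the complement open: the blocks of any other limit
  point eventually miss every block of \<open>y\<close>.\<close>

lemma closedin_tail_nhd:
  assumes "y \<in> L" shows "closedin fan_topology (tail_nhd y N)"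
proof -
  have "\<forall>\<^sub>F n in sequentially. A z n \<subseteq> I \<union> L - tail_nhd y N" if "z \<in> L" "z \<noteq> y" for z
    using fans_almost_disjoint[OF assms \<open>z \<in> L\<close>] that
    by (auto elim!: eventually_mono simp: tail_nhd_def)
       (use fan_subset disjoint assms in blast)+
  moreover have "tail_nhd y N \<subseteq> I \<union> L"
    using assms fan_subset by (auto simp: tail_nhd_def)
  ultimately show ?thesis
    by (auto simp: closedin_def openin_fan_topology fan_open_def tail_nhd_def)
qed

lemma tail_nhd_subset:
  assumes "openin fan_topology W" "y \<in> L" "y \<in> W"
  obtains N where "tail_nhd y N \<subseteq> W"
proof -
  have "\<forall>\<^sub>F n in sequentially. A y n \<subseteq> W"
    using assms by (rule openin_fan_eventually)
  then obtain N where "\<forall>n\<ge>N. A y n \<subseteq> W"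
    by (auto simp: eventually_sequentially)
  with assms have "tail_nhd y N \<subseteq> W" by (auto simp: tail_nhd_def)
  then show thesis using that by blast
qed

text \<open>Zero-dimensionality, witnessed inside \<open>fan_base\<close>: openness shows that this
  is a base, closedness yields regularity.\<close>

lemma clopen_nhd:
  assumes "openin fan_topology W" "p \<in> W"
  obtains V where "V \<in> fan_base" "openin fan_topology V" "closedin fan_topology V" "p \<in> V" "V \<subseteq> W"
proof -
  have "p \<in> I \<union> L"
    using assms openin_subset[of fan_topology W] by auto
  then consider "p \<in> I" | "p \<in> L" by blast
  then show thesis
  proof cases
    case 1
    show ?thesis
      by (rule that[of "{p}"])
         (use 1 assms closedin_fan_singleton openin_fan_subset_isolated in \<open>auto simp: fan_base_def\<close>)
  next
    case 2
    then obtain N where "tail_nhd p N \<subseteq> W" using assms tail_nhd_subset by blast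
    then show ?thesis
      using that[of "tail_nhd p N"] 2 openin_tail_nhd closedin_tail_nhd
      by (auto simp: fan_base_def tail_nhd_def)
  qed
qed

lemma regular_fan_topology: "regular_space fan_topology"
  unfolding neighbourhood_base_of_closedin[symmetric] neighbourhood_base_of
  by (metis clopen_nhd order_refl)

lemma Hausdorff_fan_topology: "Hausdorff_space fan_topology"
  by (rule regular_t1_imp_Hausdorff_space[OF regular_fan_topology])
     (simp add: t1_space_closedin_singleton closedin_fan_singleton)

section \<open>A uniform base at the limit points\<close>

lemma openin_fan_base: "B \<in> fan_base \<Longrightarrow> openin fan_topology B"
  by (auto simp: fan_base_def openin_fan_subset_isolated openin_tail_nhd)

text \<open>Blocks contain no limit points, so the only base members around a limit point are its
  own tails. These decrease, hence infinitely many of them include arbitrarily late ones.\<close>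

lemma uniform_base_fan_base: "uniform_base_at_nonisolated fan_topology fan_base"
  unfolding uniform_base_at_nonisolated_def
proof (intro conjI ballI impI allI)
  have "openin fan_topology U \<longleftrightarrow> (arbitrary union_of (\<lambda>B. B \<in> fan_base)) U" for U
    unfolding arbitrary_union_of_alt
  proof (intro iffI ballI)
    fix x assume "openin fan_topology U" "x \<in> U"
    then show "\<exists>V. V \<in> fan_base \<and> x \<in> V \<and> V \<subseteq> U"
      by (metis clopen_nhd)
  next
    assume "\<forall>x\<in>U. \<exists>V. V \<in> fan_base \<and> x \<in> V \<and> V \<subseteq> U"
    then show "openin fan_topology U"
      by (metis openin_subopen openin_fan_base)
  qed
  then show "is_base fan_topology fan_base"
    by (auto simp: is_base_def fun_eq_iff)
next
  fix x \<Q>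
  assume x: "x \<in> topspace fan_topology" "\<not> isolated_point fan_topology x"
    and \<Q>: "\<Q> \<subseteq> {B \<in> fan_base. x \<in> B} \<and> countable \<Q> \<and> infinite \<Q>"
  from x have xL: "x \<in> L" and xI: "x \<notin> I"
    by (auto simp: isolated_point_def openin_fan_subset_isolated)
  have \<Q>_tails: "\<Q> \<subseteq> range (tail_nhd x)"
  proof
    fix B assume "B \<in> \<Q>"
    with \<Q> have "B \<in> fan_base" "x \<in> B" by auto
    then consider "x \<in> I" | z N where "z \<in> L" "B = tail_nhd z N"
      by (auto simp: fan_base_def)
    then show "B \<in> range (tail_nhd x)"
    proof cases
      case 2
      then have "x = z"
        using \<open>x \<in> B\<close> xI fan_subset[of z] by (auto simp: tail_nhd_def)
      with 2 show ?thesis by simp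
    qed (use xI in simp)
  qed
  show "neighbourhood_base_at x (\<lambda>B. B \<in> \<Q>) fan_topology"
    unfolding neighbourhood_base_at_def
  proof (intro allI impI)
    fix W assume "openin fan_topology W \<and> x \<in> W"
    then obtain N where N: "tail_nhd x N \<subseteq> W"
      using xL tail_nhd_subset by blast
    \<comment> \<open>Only finitely many tails start before \<open>N\<close>, so the infinite family
      has a member starting at some \<open>n \<ge> N\<close>.\<close>
    have "\<not> \<Q> \<subseteq> tail_nhd x ` {..<N}"
      using \<Q> by (meson finite_imageI finite_lessThan finite_subset)
    then obtain B where B: "B \<in> \<Q>" "B \<notin> tail_nhd x ` {..<N}" by blast
    moreover from B \<Q>_tails obtain n where "B = tail_nhd x n" by blast
    ultimately have n: "tail_nhd x n \<in> \<Q>" "n \<ge> N" by (auto simp: leI)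
    then have "tail_nhd x n \<subseteq> W"
      using N by (fastforce simp: tail_nhd_def)
    then show "\<exists>U V. openin fan_topology U \<and> V \<in> \<Q> \<and> x \<in> U \<and> U \<subseteq> V \<and> V \<subseteq> W"
      using n openin_tail_nhd[OF xL, of n]
      by (intro exI[of _ "tail_nhd x n"]) (auto simp: tail_nhd_def)
  qed
qed

section \<open>Compact and closed discrete sets\<close>

lemma finite_compactin_isolated:
  assumes "compactin fan_topology K" "K \<subseteq> I" shows "finite K"
proof -
  have "\<exists>\<F>. finite \<F> \<and> \<F> \<subseteq> (\<lambda>p. {p}) ` K \<and> K \<subseteq> \<Union>\<F>"
    using assms by (intro compactinD[OF assms(1)]) (auto intro: openin_fan_subset_isolated)
  then obtain \<F> where "finite \<F>" "\<F> \<subseteq> (\<lambda>p. {p}) ` K" "K \<subseteq> \<Union>\<F>" by blast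
  then have "finite (\<Union>\<F>)" by (intro finite_Union) auto
  then show ?thesis
    using \<open>K \<subseteq> \<Union>\<F>\<close> finite_subset by blast
qed

text \<open>If \<open>y\<close> is in \<open>C\<close>, discreteness gives an open set meeting
  \<open>C\<close> in \<open>y\<close> alone; otherwise the complement of \<open>C\<close> is a
  neighbourhood of \<open>y\<close>. Either set swallows almost all blocks. Empty blocks lie in
  \<open>C\<close> trivially and need their own disjunct.\<close>

lemma closed_discrete_leaves_fan:
  assumes C: "closed_discrete_in fan_topology C" and y: "y \<in> L"
  shows "\<forall>\<^sub>F n in sequentially. \<not> A y n \<subseteq> C \<or> A y n = {}"
proof (cases "y \<in> C")
  case True
  have "openin (subtopology fan_topology C) {y}"
    using C True by (simp add: closed_discrete_in_def)
  then obtain W where W: "openin fan_topology W" "{y} = W \<inter> C"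
    by (auto simp: openin_subtopology)
  then have "\<forall>\<^sub>F n in sequentially. A y n \<subseteq> W"
    using W y by (intro openin_fan_eventually) auto
  then show ?thesis
  proof (rule eventually_mono)
    fix n assume "A y n \<subseteq> W"
    moreover have "y \<notin> A y n"
      using fan_subset[OF y] disjoint y by blast
    ultimately have "A y n \<inter> C = {}"
      using W(2) by auto
    then show "\<not> A y n \<subseteq> C \<or> A y n = {}"
      by auto
  qed
next
  case False
  have "openin fan_topology (I \<union> L - C)"
    using C by (metis closed_discrete_in_def closedin_def topspace_fan_topology)
  then have "\<forall>\<^sub>F n in sequentially. A y n \<subseteq> I \<union> L - C"
    using y False by (intro openin_fan_eventually) auto
  then show ?thesis
    by (rule eventually_mono) blast
qed

end

section \<open>Real codes for sequences, and maximal almost disjoint families\<close>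

lemma inj_real_sequences_into_unit_interval:
  "\<exists>e :: (nat \<Rightarrow> real) \<Rightarrow> real. inj e \<and> range e \<subseteq> {0..<1}"
proof -
  obtain g :: "nat set \<Rightarrow> real" where g: "inj g" "range g \<subseteq> {0..<1}"
    using nat_sets_lepoll_reals01 by (auto simp: lepoll_def)
  \<comment> \<open>A Dedekind-style code: the pairs of an index \<open>n\<close> and a rational
    below \<open>s n\<close>, numbered by \<open>to_nat\<close>. Density of the rationals recovers
    every \<open>s n\<close>.\<close>
  define c where "c s = to_nat ` {(n, q :: rat). of_rat q < s n}" for s :: "nat \<Rightarrow> real"
  have "s n \<le> t n" if "c s = c t" for s t n
  proof (rule ccontr)
    assume "\<not> s n \<le> t n"
    then obtain q where q: "t n < of_rat q" "of_rat q < s n"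
      using of_rat_dense[of "t n" "s n"] by auto
    have "{(n, q :: rat). of_rat q < s n} = {(n, q). of_rat q < t n}"
      using that by (simp add: c_def inj_image_eq_iff)
    with q show False by (auto simp: set_eq_iff)
  qed
  then have "inj c"
    by (intro injI ext order_antisym) auto
  with g have "inj (\<lambda>s. g (c s)) \<and> range (\<lambda>s. g (c s)) \<subseteq> {0..<1}"
    by (auto simp: inj_def)
  then show ?thesis by blast
qed

text \<open>By Zorn: an infinite set meeting every range finitely would contain the range of an
  injective sequence that could be adjoined. Keeping sequences instead of their ranges supplies the
  enumerations that later index the blocks.\<close>

lemma maximal_almost_disjoint_sequences:
  fixes D :: "'a set"
  shows "\<exists>\<S> :: (nat \<Rightarrow> 'a) set. (\<forall>s\<in>\<S>. inj s \<and> range s \<subseteq> D) \<and>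
    (\<forall>s\<in>\<S>. \<forall>t\<in>\<S>. s \<noteq> t \<longrightarrow> finite (range s \<inter> range t)) \<and>
    (\<forall>S. infinite S \<longrightarrow> S \<subseteq> D \<longrightarrow> (\<exists>s\<in>\<S>. infinite (range s \<inter> S)))"
proof -
  define AD where "AD = {\<S> :: (nat \<Rightarrow> 'a) set. (\<forall>s\<in>\<S>. inj s \<and> range s \<subseteq> D) \<and>
    (\<forall>s\<in>\<S>. \<forall>t\<in>\<S>. s \<noteq> t \<longrightarrow> finite (range s \<inter> range t))}"
  have "\<exists>\<S>\<in>AD. \<forall>\<T>\<in>AD. \<S> \<subseteq> \<T> \<longrightarrow> \<T> = \<S>"
  proof (rule subset_Zorn')
    fix \<C> assume "subset.chain AD \<C>"
    then have sub: "\<C> \<subseteq> AD" and ch: "\<And>X Y. X \<in> \<C> \<Longrightarrow> Y \<in> \<C> \<Longrightarrow> X \<subseteq> Y \<or> Y \<subseteq> X"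
      by (auto simp: subset_chain_def)
    have "finite (range s \<inter> range t)"
      if "s \<in> X" "X \<in> \<C>" "t \<in> Y" "Y \<in> \<C>" "s \<noteq> t" for s t X Y
      using ch[OF \<open>X \<in> \<C>\<close> \<open>Y \<in> \<C>\<close>] sub that unfolding AD_def by blast
    moreover have "inj s \<and> range s \<subseteq> D" if "s \<in> X" "X \<in> \<C>" for s X
      using sub that unfolding AD_def by blast
    ultimately show "\<Union>\<C> \<in> AD"
      unfolding AD_def by blast
  qed
  then obtain \<S> where \<S>: "\<S> \<in> AD" and max: "\<And>\<T>. \<T> \<in> AD \<Longrightarrow> \<S> \<subseteq> \<T> \<Longrightarrow> \<T> = \<S>"
    by blast
  have "\<exists>s\<in>\<S>. infinite (range s \<inter> S)" if "infinite S" "S \<subseteq> D" for S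
  proof (rule ccontr)
    assume fin: "\<not> ?thesis"
    obtain s :: "nat \<Rightarrow> 'a" where s: "inj s" "range s \<subseteq> S"
      using infinite_countable_subset \<open>infinite S\<close> by blast
    have meet: "finite (range t \<inter> range s)" if "t \<in> \<S>" for t
      using fin that s by (metis finite_subset inf_mono order_refl)
    then have "insert s \<S> \<in> AD"
      using \<S> s \<open>S \<subseteq> D\<close> by (auto simp: AD_def Int_commute)
    then have "s \<in> \<S>" using max by blast
    \<comment> \<open>Apply \<open>meet\<close> to \<open>t = s\<close>: the range of
      \<open>s\<close> meets itself finitely.\<close>
    with meet have "finite (range s)" by fastforce
    with s show False by (simp add: finite_image_iff)
  qed
  with \<S> show ?thesis
    by (intro exI[of _ \<S>]) (simp add: AD_def)
qed

text \<open>Turns finite intersections of ranges into the eventual statements that the locale asks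
  for.\<close>

lemma eventually_notin_finite_of_inj:
  assumes "inj s" "finite F" shows "\<forall>\<^sub>F n in sequentially. s n \<notin> F"
proof -
  have "finite {n. s n \<in> F}"
    using finite_vimageI[OF assms(2,1)] by (simp add: vimage_def)
  then show ?thesis
    by (simp add: cofinite_eq_sequentially[symmetric] eventually_cofinite)
qed

section \<open>The two spaces and the projection between them\<close>

theorem mainTheorem3:
  shows "\<exists>(X :: (real \<times> nat) topology) (Y :: real topology) f.
           regular_space X \<and> Hausdorff_space X \<and>
           (\<exists>\<B>. uniform_base_at_nonisolated X \<B>) \<and>
           Hausdorff_space Y \<and>
           continuous_map X Y f \<and> closed_map X Y f \<and> f ` topspace X = topspace Y \<and>
           \<not> (\<exists>Z. Z \<subseteq> topspace Y \<and> sigma_closed_discrete_in Y Z \<and>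
                  (\<forall>y \<in> topspace Y - Z. compactin X {x \<in> topspace X. f x = y}))"
proof -
  \<comment> \<open>Uncountable, and disjoint from the unit interval that receives the codes of the
    sequences, so that both kinds of points are reals.\<close>
  define D :: "real set" where "D = {-1<..<0}"
  obtain \<S> :: "(nat \<Rightarrow> real) set" where seq: "\<forall>s\<in>\<S>. inj s \<and> range s \<subseteq> D"
    and ad: "\<forall>s\<in>\<S>. \<forall>t\<in>\<S>. s \<noteq> t \<longrightarrow> finite (range s \<inter> range t)"
    and mad: "\<forall>S. infinite S \<longrightarrow> S \<subseteq> D \<longrightarrow> (\<exists>s\<in>\<S>. infinite (range s \<inter> S))"
    using maximal_almost_disjoint_sequences[of D] by (elim exE conjE)
  obtain e :: "(nat \<Rightarrow> real) \<Rightarrow> real" where e: "inj e" "range e \<subseteq> {0..<1}"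
    using inj_real_sequences_into_unit_interval by blast
  define L where "L = e ` \<S>"
  \<comment> \<open>Decoding: on \<open>L\<close> this returns the sequence whose limit the point is
    to be.\<close>
  define a where "a = inv e"
  have a_mem: "a y \<in> \<S>" if "y \<in> L" for y
    using that e by (auto simp: L_def a_def)
  have a_seq: "inj (a y)" "range (a y) \<subseteq> D" if "y \<in> L" for y
    using seq a_mem[OF that] by blast+
  have a_in: "a y n \<in> D" if "y \<in> L" for y n
    using a_seq[OF that] by auto
  have a_ad: "finite (range (a y) \<inter> range (a z))" if "y \<in> L" "z \<in> L" "y \<noteq> z" for y z
  proof -
    have "a y \<noteq> a z"
      using that e by (auto simp: L_def a_def)
    with that show ?thesis
      using ad a_mem by blast
  qed
  have a_ev: "\<forall>\<^sub>F n in sequentially. \<forall>m. a z n \<noteq> a y m" if "y \<in> L" "z \<in> L" "y \<noteq> z" for y z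
    using eventually_notin_finite_of_inj[OF a_seq(1)[OF \<open>z \<in> L\<close>] a_ad[OF that]]
    by (rule eventually_mono) auto
  have a_pt: "\<forall>\<^sub>F n in sequentially. p \<noteq> a y n" if "y \<in> L" for y p
    using eventually_notin_finite_of_inj[OF a_seq(1)[OF that], of "{p}"]
    by (auto elim: eventually_mono)
  have DL: "D \<inter> L = {}"
  proof -
    have "L \<subseteq> {0..<1}" using e by (auto simp: L_def)
    then show ?thesis by (auto simp: D_def)
  qed

  interpret Y: fan_space D L "\<lambda>y n. {a y n}"
    by unfold_locales (use DL a_in a_pt a_ev in auto)
  \<comment> \<open>Each isolated point \<open>d\<close> becomes the column
    \<open>{d} \<times> UNIV\<close>, and blocks are whole columns. Limit points stay single, at
    second coordinate \<open>0\<close>.\<close>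
  interpret X: fan_space "D \<times> UNIV" "L \<times> {0::nat}" "\<lambda>y n. {a (fst y) n} \<times> UNIV"
  proof unfold_locales
    fix y p assume "y \<in> L \<times> {0::nat}" "p \<in> D \<times> (UNIV :: nat set)"
    then show "\<forall>\<^sub>F n in sequentially. p \<notin> {a (fst y) n} \<times> UNIV"
      using a_pt[of "fst y" "fst p"] by (auto elim!: eventually_mono)
  next
    fix y z assume "y \<in> L \<times> {0::nat}" "z \<in> L \<times> {0::nat}" "y \<noteq> z"
    then have "\<forall>\<^sub>F n in sequentially. \<forall>m. a (fst z) n \<noteq> a (fst y) m"
      by (intro a_ev) auto
    then show "\<forall>\<^sub>F n in sequentially.
        {a (fst z) n} \<times> UNIV \<inter> (\<Union>m. {a (fst y) m} \<times> (UNIV :: nat set)) = {}"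
      by (rule eventually_mono) auto
  qed (use DL a_in in auto)

  let ?X = X.fan_topology and ?Y = Y.fan_topology
  have cont: "continuous_map ?X ?Y fst"
    unfolding continuous_map
  proof (intro conjI allI impI)
    show "fst ` topspace ?X \<subseteq> topspace ?Y" by auto
    fix U assume "openin ?Y U"
    then have U: "\<And>y. y \<in> L \<Longrightarrow> y \<in> U \<Longrightarrow> \<forall>\<^sub>F n in sequentially. a y n \<in> U"
      using Y.openin_fan_eventually by auto
    show "openin ?X {x \<in> topspace ?X. fst x \<in> U}"
      unfolding X.openin_fan_topology X.fan_open_def
    proof (intro conjI ballI)
      fix x assume "x \<in> L \<times> {0} \<inter> {x \<in> topspace ?X. fst x \<in> U}"
      then have x: "fst x \<in> L" "fst x \<in> U" by auto
      show "\<forall>\<^sub>F n in sequentially. {a (fst x) n} \<times> UNIV \<subseteq> {x \<in> topspace ?X. fst x \<in> U}"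
        using U[OF x] by (rule eventually_mono) (use a_in[OF x(1)] in auto)
    qed auto
  qed
  have clo: "closed_map ?X ?Y fst"
    unfolding closed_map_def
  proof (intro allI impI)
    fix C assume C: "closedin ?X C"
    then have C_sub: "C \<subseteq> D \<times> UNIV \<union> L \<times> {0}"
      using closedin_subset by force
    have C_open: "openin ?X (D \<times> UNIV \<union> L \<times> {0} - C)"
      using C by (simp add: closedin_def)
    have "\<forall>\<^sub>F n in sequentially. a y n \<in> D \<union> L - fst ` C" if y: "y \<in> L" "y \<notin> fst ` C" for y
    proof -
      have "(y, 0) \<in> D \<times> UNIV \<union> L \<times> {0} - C"
        using y by (auto simp: image_iff)
      then have "\<forall>\<^sub>F n in sequentially. {a y n} \<times> UNIV \<subseteq> D \<times> UNIV \<union> L \<times> {0} - C"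
        using X.openin_fan_eventually[OF C_open, of "(y, 0)"] y by simp
      then show ?thesis
        by (rule eventually_mono) (use a_in[OF y(1)] in \<open>auto simp: subset_iff\<close>)
    qed
    then have "Y.fan_open (D \<union> L - fst ` C)"
      by (auto simp: Y.fan_open_def)
    then show "closedin ?Y (fst ` C)"
      using C_sub by (auto simp: closedin_def Y.openin_fan_topology)
  qed
  have onto: "fst ` topspace ?X = topspace ?Y"
    by (simp add: image_Un)
  have no_Z_aux: "False" if Z: "sigma_closed_discrete_in ?Y Z"
    and comp: "\<forall>y \<in> topspace ?Y - Z. compactin ?X {x \<in> topspace ?X. fst x = y}" for Z
  proof -
    have "D \<subseteq> Z"
    proof (rule ccontr)
      assume "\<not> D \<subseteq> Z"
      then obtain d where d: "d \<in> D" "d \<notin> Z" by blast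
      have "compactin ?X {x \<in> topspace ?X. fst x = d}"
        using d by (intro bspec[OF comp]) simp
      \<comment> \<open>Since \<open>d\<close> is not in \<open>L\<close>, the fibre is a full
        column of isolated points, too large to be compact.\<close>
      also have "{x \<in> topspace ?X. fst x = d} = {d} \<times> UNIV"
        using DL d by auto
      finally have "compactin ?X ({d} \<times> UNIV)" .
      then have "finite ({d} \<times> (UNIV :: nat set))"
        using X.finite_compactin_isolated d by blast
      then show False by (simp add: finite_cartesian_product_iff)
    qed
    obtain \<C> where \<C>: "countable \<C>" "\<And>C. C \<in> \<C> \<Longrightarrow> closed_discrete_in ?Y C" "\<Union>\<C> = Z"
      using Z by (auto simp: sigma_closed_discrete_in_def union_of_def)
    \<comment> \<open>Pigeonhole: countably many finite traces cannot cover the uncountable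
      \<open>D\<close>.\<close>
    have "\<exists>C\<in>\<C>. infinite (C \<inter> D)"
    proof (rule ccontr)
      assume "\<not> ?thesis"
      then have "countable (\<Union>C\<in>\<C>. C \<inter> D)"
        using \<C>(1) by (intro countable_UN) (auto intro: countable_finite)
      moreover have "(\<Union>C\<in>\<C>. C \<inter> D) = D"
        using \<C>(3) \<open>D \<subseteq> Z\<close> by blast
      ultimately show False
        using uncountable_open_interval[of "-1" "0::real"] by (simp add: D_def)
    qed
    then obtain C where C: "C \<in> \<C>" "infinite (C \<inter> D)" by blast
    then obtain s where s: "s \<in> \<S>" "infinite (range s \<inter> (C \<inter> D))"
      using mad by blast
    \<comment> \<open>The limit point of the sequence that maximality supplies for
      \<open>C \<inter> D\<close>.\<close>
    define y where "y = e s"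
    have y: "y \<in> L" "a y = s"
      using s e by (auto simp: y_def L_def a_def)
    \<comment> \<open>The blocks of \<open>y\<close> are the non-empty singletons
      \<open>{s n}\<close>, so eventual non-inclusion means that \<open>s\<close> leaves
      \<open>C\<close>, against its infinitely many values there.\<close>
    have "\<forall>\<^sub>F n in sequentially. s n \<notin> C"
      using Y.closed_discrete_leaves_fan[OF \<C>(2)[OF C(1)] y(1)] y(2) by simp
    then have "finite {n. s n \<in> C}"
      by (simp add: cofinite_eq_sequentially[symmetric] eventually_cofinite)
    then have "finite (s ` {n. s n \<in> C})" by simp
    moreover have "range s \<inter> (C \<inter> D) \<subseteq> s ` {n. s n \<in> C}" by auto
    ultimately show False
      using s(2) finite_subset by blast
  qed
  have no_Z: "\<not> (\<exists>Z. Z \<subseteq> topspace ?Y \<and> sigma_closed_discrete_in ?Y Z \<and>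
      (\<forall>y \<in> topspace ?Y - Z. compactin ?X {x \<in> topspace ?X. fst x = y}))"
  proof (intro notI, elim exE conjE)
    fix Z
    assume "sigma_closed_discrete_in ?Y Z"
      and "\<forall>y \<in> topspace ?Y - Z. compactin ?X {x \<in> topspace ?X. fst x = y}"
    then show False by (rule no_Z_aux)
  qed
  show ?thesis
    by (intro exI conjI)
       (rule X.regular_fan_topology X.Hausdorff_fan_topology X.uniform_base_fan_base
          Y.Hausdorff_fan_topology cont clo onto no_Z)+
qed

end
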